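(* For every integer $N\ge 0$ and all values of the tension parameters $\alpha,\beta$, each of the schemes $S_{a_{2N+2}}$, $S_{a_{2N+3}}$ and $S_{a^{I}_{2N+4}}$ reproduces polynomials up to degree $2N+1$.
   Context: A binary subdivision scheme with finitely supported real mask maps a sequence $f^k=(f^k_i)_{i\in\mathbb Z}$ to a refined sequence $f^{k+1}=(f^{k+1}_i)_{i\in\mathbb Z}$, with the same rules at each level $k\ge 0$. Values $f^k_i$ are attached to the parameters $i/2^k$ (the primal parametrization, shift parameter $\tau=0$); a continuous function $F$ is the limit of the scheme for the initial data $f^0$ if for every compact $K\subset\mathbb R$ one has $\sup_{i:\,i/2^k\in K}|F(i/2^k)-f^k_i|\to 0$ as $k\to\infty$. Polynomial reproduction: the scheme reproduces polynomials up to degree $d$ if, whenever the initial data are sampled from a polynomial $g$ of degree at most $d$ ($f^0_i=g(i)$), the limit exists and equals $g$. Family $S_{a_{2N+2}}$ (one tension parameter $\alpha\in\mathbb R$). Given a sequence $(f_i)_{i\in\mathbb Z}$, define for all $i\in\mathbb Z$ the initial values $$p_{2i,1}=f_i+\alpha(f_{i-1}-2f_i+f_{i+1}),\qquad p_{2i+1,1}=\tfrac12 f_i+\tfrac12 f_{i+1},$$ $$C_{2i,1}=f_{i-1}-f_i+f_{i+1},\qquad C_{2i+1,1}=\tfrac12(f_i+f_{i+1}),$$ and, recursively for $n\ge 1$, $$C_{2i,n+1}=(C_{2i,n}-C_{2(i+1),n})+(C_{2i,n}-C_{2(i-1),n}),$$ $$C_{2i+1,n+1}=\tfrac1n\left(\tfrac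 n4-\tfrac18\right)\left[(C_{2i+1,n}-C_{2(i+1)+1,n})+(C_{2i+1,n}-C_{2(i-1)+1,n})\right],$$ $$p_{2i,n+1}=p_{2i,n}+\alpha\, C_{2i,n+1},\qquad p_{2i+1,n+1}=p_{2i+1,n}+C_{2i+1,n+1}.$$ For $N\ge 0$ the mask coefficients $a_{j,N+1}$, $-2(N+1)\le j\le 2(N+1)$ (all other coefficients being $0$), are defined by writing $$p_{2i,N+1}=\sum_{j=-N-1}^{N+1}a_{2j,N+1}f_{i+j},\qquad p_{2i+1,N+1}=\sum_{j=-N-1}^{N}a_{2j+1,N+1}f_{i+j+1}.$$ The scheme $S_{a_{2N+2}}$ is $f^{k+1}_{2i}=\sum_{j=-N-1}^{N+1}a_{2j,N+1}f^k_{i+j}$, $f^{k+1}_{2i+1}=\sum_{j=-N-1}^{N}a_{2j+1,N+1}f^k_{i+j+1}$. Family $S_{a_{2N+3}}$ (two tension parameters $-1<\alpha<1$, $-1<\beta<1$). It is $f^{k+1}_{2i}=\sum_{j=-N-1}^{N+1}b_{2j}f^k_{i+j}$, $f^{k+1}_{2i+1}=\sum_{j=-N-2}^{N+1}b_{2j+1}f^k_{i+j+1}$, where $b_{2j}=a_{2j,N+1}$ for $-N-1\le j\le N+1$, $$b_{2j+1}=a_{2j+1,N+1}+(-1)^{j+N+1}\,\frac{2j+1}{N-j+1}\binom{2N+2}{N+j+2}\beta(1-\alpha)\quad\text{for }-N-1\le j\le N,$$ and $b_{2j+1}=\beta(1-\alpha)$ for $j=-(N+2)$ and $j=N+1$.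 Family $S_{a^{I}_{2N+4}}$ (one tension parameter $-1<\beta<1$). It is the scheme $S_{a_{2N+3}}$ with $\alpha=0$ (so $f^{k+1}_{2i}=f^k_i$). *)

theory Defs
  imports
    Complex_Main
    "HOL-Computational_Algebra.Polynomial"
    "HOL-Library.Extended_Nonnegative_Real"
begin

text \<open>
  A (stationary) scheme is a refinement operator \<open>S\<close> on bi-infinite real sequences; the data at
  level \<open>k\<close> are \<open>(S ^^ k) f0\<close>, attached to the parameters \<open>i / 2 ^ k\<close>. The supremum is
  taken in \<^typ>\<open>ennreal\<close>: it is always defined, possibly infinite, and equals \<open>0\<close> when no
  parameter of level \<open>k\<close> lies in \<open>K\<close>.
\<close>

definition is_limit ::
  "((int \<Rightarrow> real) \<Rightarrow> int \<Rightarrow> real) \<Rightarrow> (int \<Rightarrow> real) \<Rightarrow> (real \<Rightarrow> real) \<Rightarrow> bool" where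
  "is_limit S f0 F \<longleftrightarrow> continuous_on UNIV F \<and>
     (\<forall>K. compact K \<longrightarrow>
        (\<lambda>k. SUP i\<in>{i :: int. real_of_int i / 2 ^ k \<in> K}.
               ennreal \<bar>F (real_of_int i / 2 ^ k) - (S ^^ k) f0 i\<bar>) \<longlonglongrightarrow> 0)"

definition reproduces_polys :: "((int \<Rightarrow> real) \<Rightarrow> int \<Rightarrow> real) \<Rightarrow> nat \<Rightarrow> bool" where
  "reproduces_polys S d \<longleftrightarrow>
     (\<forall>g :: real poly. degree g \<le> d \<longrightarrow> is_limit S (\<lambda>i. poly g (real_of_int i)) (poly g))"

text \<open>
  \<open>corr f n m\<close> is \<open>C\<^sub>m\<^sub>,\<^sub>n\<close> and \<open>pval \<alpha> f n m\<close> is \<open>p\<^sub>m\<^sub>,\<^sub>n\<close>, computed from the sequence \<open>f\<close>, for \<open>n \<ge> 1\<close>;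
  the values at \<open>n = 0\<close> are never used. Since \<open>div\<close> rounds down, \<open>m div 2\<close> is \<open>i\<close> both for
  \<open>m = 2 * i\<close> and for \<open>m = 2 * i + 1\<close>.
\<close>

fun corr :: "(int \<Rightarrow> real) \<Rightarrow> nat \<Rightarrow> int \<Rightarrow> real" where
  "corr f 0 m = 0"
| "corr f (Suc n) m =
     (if n = 0 then
        (if even m then f (m div 2 - 1) - f (m div 2) + f (m div 2 + 1)
         else 1 / 2 * (f (m div 2) + f (m div 2 + 1)))
      else
        (if even m then (corr f n m - corr f n (m + 2)) + (corr f n m - corr f n (m - 2))
         else 1 / real n * (real n / 4 - 1 / 8) *
                ((corr f n m - corr f n (m + 2)) + (corr f n m - corr f n (m - 2)))))"

fun pval :: "real \<Rightarrow> (int \<Rightarrow> real) \<Rightarrow> nat \<Rightarrow> int \<Rightarrow> real" where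
  "pval \<alpha> f 0 m = 0"
| "pval \<alpha> f (Suc n) m =
     (if n = 0 then
        (if even m then f (m div 2) + \<alpha> * (f (m div 2 - 1) - 2 * f (m div 2) + f (m div 2 + 1))
         else 1 / 2 * f (m div 2) + 1 / 2 * f (m div 2 + 1))
      else
        (if even m then pval \<alpha> f n m + \<alpha> * corr f (Suc n) m
         else pval \<alpha> f n m + corr f (Suc n) m))"

definition is_mask_a :: "real \<Rightarrow> nat \<Rightarrow> (int \<Rightarrow> real) \<Rightarrow> bool" where
  "is_mask_a \<alpha> N a \<longleftrightarrow>
     (\<forall>f i. pval \<alpha> f (N + 1) (2 * i) = (\<Sum>j = - int N - 1..int N + 1. a (2 * j) * f (i + j))) \<and>
     (\<forall>f i. pval \<alpha> f (N + 1) (2 * i + 1) =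
        (\<Sum>j = - int N - 1..int N. a (2 * j + 1) * f (i + j + 1))) \<and>
     (\<forall>j. \<bar>j\<bar> > 2 * (int N + 1) \<longrightarrow> a j = 0)"

text \<open>The description is proper: see \<open>is_mask_a_ex1\<close> below.\<close>

definition mask_a :: "real \<Rightarrow> nat \<Rightarrow> int \<Rightarrow> real" where
  "mask_a \<alpha> N = (THE a. is_mask_a \<alpha> N a)"

definition mask_b :: "real \<Rightarrow> real \<Rightarrow> nat \<Rightarrow> int \<Rightarrow> real" where
  "mask_b \<alpha> \<beta> N m =
     (if even m then mask_a \<alpha> N m
      else let j = m div 2 in
        if - int N - 1 \<le> j \<and> j \<le> int N then
          mask_a \<alpha> N m +
          (- 1) powi (j + int N + 1) * ((2 * real_of_int j + 1) / (real N - real_of_int j + 1)) *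
            real ((2 * N + 2) choose nat (int N + j + 2)) * \<beta> * (1 - \<alpha>)
        else if j = - (int N + 2) \<or> j = int N + 1 then \<beta> * (1 - \<alpha>)
        else 0)"

definition scheme_a :: "real \<Rightarrow> nat \<Rightarrow> (int \<Rightarrow> real) \<Rightarrow> int \<Rightarrow> real" where
  "scheme_a \<alpha> N f m =
     (let i = m div 2 in
      if even m then \<Sum>j = - int N - 1..int N + 1. mask_a \<alpha> N (2 * j) * f (i + j)
      else \<Sum>j = - int N - 1..int N. mask_a \<alpha> N (2 * j + 1) * f (i + j + 1))"

definition scheme_b :: "real \<Rightarrow> real \<Rightarrow> nat \<Rightarrow> (int \<Rightarrow> real) \<Rightarrow> int \<Rightarrow> real" where
  "scheme_b \<alpha> \<beta> N f m =
     (let i = m div 2 in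
      if even m then \<Sum>j = - int N - 1..int N + 1. mask_b \<alpha> \<beta> N (2 * j) * f (i + j)
      else \<Sum>j = - int N - 2..int N + 1. mask_b \<alpha> \<beta> N (2 * j + 1) * f (i + j + 1))"

definition scheme_I :: "real \<Rightarrow> nat \<Rightarrow> (int \<Rightarrow> real) \<Rightarrow> int \<Rightarrow> real" where
  "scheme_I \<beta> N = scheme_b 0 \<beta> N"

definition has_stencil :: "int \<Rightarrow> int \<Rightarrow> ((int \<Rightarrow> real) \<Rightarrow> int \<Rightarrow> real) \<Rightarrow> bool" where
  "has_stencil l h T \<longleftrightarrow> (\<exists>c. \<forall>f i. T f i = (\<Sum>j = l..h. c j * f (i + j)))"

lemma has_stencil_at:
  assumes "l \<le> k" "k \<le> h"
  shows "has_stencil l h (\<lambda>f i. f (i + k))"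
  unfolding has_stencil_def
  by (rule exI[of _ "\<lambda>j. if j = k then 1 else 0"])
     (use assms in \<open>simp add: if_distrib[of "\<lambda>x. x * _"] cong: if_cong\<close>)

lemma has_stencil_scale:
  assumes "has_stencil l h T"
  shows "has_stencil l h (\<lambda>f i. r * T f i)"
proof -
  obtain c where c: "\<And>f i. T f i = (\<Sum>j = l..h. c j * f (i + j))"
    using assms unfolding has_stencil_def by blast
  show ?thesis
    unfolding has_stencil_def
    by (rule exI[of _ "\<lambda>j. r * c j"]) (simp add: c sum_distrib_left mult.assoc)
qed

lemma has_stencil_add:
  assumes "has_stencil l h T" "has_stencil l h U"
  shows "has_stencil l h (\<lambda>f i. T f i + U f i)"
proof -
  obtain c d where c: "\<And>f i. T f i = (\<Sum>j = l..h. c j * f (i + j))"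
    and d: "\<And>f i. U f i = (\<Sum>j = l..h. d j * f (i + j))"
    using assms unfolding has_stencil_def by blast
  show ?thesis
    unfolding has_stencil_def
    by (rule exI[of _ "\<lambda>j. c j + d j"]) (simp add: c d sum.distrib distrib_right)
qed

lemma has_stencil_diff:
  assumes "has_stencil l h T" "has_stencil l h U"
  shows "has_stencil l h (\<lambda>f i. T f i - U f i)"
  using has_stencil_add[OF assms(1) has_stencil_scale[OF assms(2), of "-1"]] by simp

lemma has_stencil_shift:
  assumes "has_stencil l h T" "l' \<le> l + k" "h + k \<le> h'"
  shows "has_stencil l' h' (\<lambda>f i. T f (i + k))"
proof -
  obtain c where c: "\<And>f i. T f i = (\<Sum>j = l..h. c j * f (i + j))"
    using assms unfolding has_stencil_def by blast
  have "T f (i + k) =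
      (\<Sum>j = l'..h'. (if l + k \<le> j \<and> j \<le> h + k then c (j - k) else 0) * f (i + j))" for f i
  proof -
    have "T f (i + k) = (\<Sum>j = l + k..h + k. c (j - k) * f (i + j))"
      unfolding c
      by (rule sum.reindex_bij_witness[of _ "\<lambda>j. j - k" "\<lambda>j. j + k"]) (auto simp: algebra_simps)
    also have "\<dots> =
      (\<Sum>j = l'..h'. (if l + k \<le> j \<and> j \<le> h + k then c (j - k) else 0) * f (i + j))"
      by (rule sum.mono_neutral_cong_left) (use assms in auto)
    finally show ?thesis .
  qed
  then show ?thesis
    unfolding has_stencil_def
    by (intro exI[of _ "\<lambda>j. if l + k \<le> j \<and> j \<le> h + k then c (j - k) else 0"] allI)
qed

lemma has_stencil_second_diff:
  assumes "has_stencil l h T"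
  shows "has_stencil (l - 1) (h + 1) (\<lambda>f i. (T f i - T f (i + 1)) + (T f i - T f (i - 1)))"
proof -
  have 0: "has_stencil (l - 1) (h + 1) T"
    using has_stencil_shift[OF assms, of "l - 1" 0 "h + 1"] by simp
  have 1: "has_stencil (l - 1) (h + 1) (\<lambda>f i. T f (i + 1))"
    using has_stencil_shift[OF assms, of "l - 1" 1 "h + 1"] by simp
  have 2: "has_stencil (l - 1) (h + 1) (\<lambda>f i. T f (i - 1))"
    using has_stencil_shift[OF assms, of "l - 1" "-1" "h + 1"] by simp
  show ?thesis
    by (intro has_stencil_add has_stencil_diff 0 1 2)
qed

lemma has_stencil_corr_even: "has_stencil (- int n - 1) (int n + 1) (\<lambda>f i. corr f (Suc n) (2 * i))"
proof (induction n)
  case 0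
  have "has_stencil (-1) 1 (\<lambda>f i. f (i + -1) - f (i + 0) + f (i + 1))"
    by (intro has_stencil_add has_stencil_diff has_stencil_at) auto
  then show ?case by simp
next
  case (Suc n)
  have eq: "corr f (Suc (Suc n)) (2 * i) =
      (corr f (Suc n) (2 * i) - corr f (Suc n) (2 * (i + 1))) +
      (corr f (Suc n) (2 * i) - corr f (Suc n) (2 * (i - 1)))" for f i
    by (simp only: corr.simps(2)[of f "Suc n"]) (simp del: corr.simps add: algebra_simps)
  show ?case
    using has_stencil_second_diff[OF Suc] unfolding eq by (simp add: algebra_simps del: corr.simps)
qed

lemma has_stencil_corr_odd: "has_stencil (- int n) (int n + 1) (\<lambda>f i. corr f (Suc n) (2 * i + 1))"
proof (induction n)
  case 0
  have "has_stencil 0 1 (\<lambda>f i. 1 / 2 * (f (i + 0) + f (i + 1)))"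
    by (intro has_stencil_add has_stencil_scale has_stencil_at) auto
  then show ?case by simp
next
  case (Suc n)
  define r where "r = 1 / real (Suc n) * (real (Suc n) / 4 - 1 / 8)"
  have eq: "corr f (Suc (Suc n)) (2 * i + 1) =
      r * ((corr f (Suc n) (2 * i + 1) - corr f (Suc n) (2 * (i + 1) + 1)) +
      (corr f (Suc n) (2 * i + 1) - corr f (Suc n) (2 * (i - 1) + 1)))" for f i
    by (simp only: corr.simps(2)[of f "Suc n"] r_def) (simp del: corr.simps add: algebra_simps)
  show ?case
  proof -
    have "- int (Suc n) = - int n - 1" "int (Suc n) + 1 = int n + 1 + 1"
      by simp_all
    then show ?thesis
      using has_stencil_scale[OF has_stencil_second_diff[OF Suc], of r] unfolding eq by metis
  qed
qed

lemma has_stencil_pval_even: "has_stencil (- int n - 1) (int n + 1) (\<lambda>f i. pval \<alpha> f (Suc n) (2 * i))"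
proof (induction n)
  case 0
  have "has_stencil (-1) 1 (\<lambda>f i. f (i + 0) + \<alpha> * (f (i + -1) - 2 * f (i + 0) + f (i + 1)))"
    by (intro has_stencil_add has_stencil_diff has_stencil_scale has_stencil_at) auto
  then show ?case by simp
next
  case (Suc n)
  have eq: "pval \<alpha> f (Suc (Suc n)) (2 * i) =
      pval \<alpha> f (Suc n) (2 * i) + \<alpha> * corr f (Suc (Suc n)) (2 * i)" for f i
    by (simp only: pval.simps(2)[of \<alpha> f "Suc n"]) (simp del: corr.simps pval.simps)
  have "has_stencil (- int (Suc n) - 1) (int (Suc n) + 1) (\<lambda>f i. pval \<alpha> f (Suc n) (2 * i))"
    using has_stencil_shift[OF Suc, of "- int (Suc n) - 1" 0 "int (Suc n) + 1"]
    by (simp del: pval.simps)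
  then show ?case
    unfolding eq by (intro has_stencil_add has_stencil_scale has_stencil_corr_even)
qed

lemma has_stencil_pval_odd: "has_stencil (- int n) (int n + 1) (\<lambda>f i. pval \<alpha> f (Suc n) (2 * i + 1))"
proof (induction n)
  case 0
  have "has_stencil 0 1 (\<lambda>f i. 1 / 2 * f (i + 0) + 1 / 2 * f (i + 1))"
    by (intro has_stencil_add has_stencil_scale has_stencil_at) auto
  then show ?case by simp
next
  case (Suc n)
  have eq: "pval \<alpha> f (Suc (Suc n)) (2 * i + 1) =
      pval \<alpha> f (Suc n) (2 * i + 1) + corr f (Suc (Suc n)) (2 * i + 1)" for f i
    by (simp only: pval.simps(2)[of \<alpha> f "Suc n"]) (simp del: corr.simps pval.simps)
  have "has_stencil (- int (Suc n)) (int (Suc n) + 1) (\<lambda>f i. pval \<alpha> f (Suc n) (2 * i + 1))"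
    using has_stencil_shift[OF Suc, of "- int (Suc n)" 0 "int (Suc n) + 1"]
    by (simp del: pval.simps)
  then show ?case
    unfolding eq by (intro has_stencil_add has_stencil_corr_odd)
qed

lemma is_mask_a_ex1: "\<exists>!a. is_mask_a \<alpha> N a"
proof -
  obtain c where c: "\<And>f i. pval \<alpha> f (Suc N) (2 * i) =
      (\<Sum>j = - int N - 1..int N + 1. c j * f (i + j))"
    using has_stencil_pval_even[of N \<alpha>] unfolding has_stencil_def by blast
  obtain d where d: "\<And>f i. pval \<alpha> f (Suc N) (2 * i + 1) =
      (\<Sum>j = - int N..int N + 1. d j * f (i + j))"
    using has_stencil_pval_odd[of N \<alpha>] unfolding has_stencil_def by blast
  have d': "pval \<alpha> f (Suc N) (2 * i + 1) =
      (\<Sum>j = - int N - 1..int N. d (j + 1) * f (i + j + 1))" for f i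
    unfolding d
    by (rule sum.reindex_bij_witness[of _ "\<lambda>j. j + 1" "\<lambda>j. j - 1"]) (auto simp: algebra_simps)
  define a where "a m = (if \<bar>m\<bar> > 2 * (int N + 1) then 0
      else if even m then c (m div 2) else d (m div 2 + 1))" for m
  have "is_mask_a \<alpha> N a"
    unfolding is_mask_a_def Suc_eq_plus1[symmetric] c d'
    by (intro conjI allI sum.cong refl) (auto simp: a_def)
  moreover have "a' = a''" if a': "is_mask_a \<alpha> N a'" and a'': "is_mask_a \<alpha> N a''" for a' a''
  proof
    fix m
    have ev: "b (2 * k) = pval \<alpha> (\<lambda>j. if j = k then 1 else 0) (N + 1) (2 * 0)"
      if "is_mask_a \<alpha> N b" "- int N - 1 \<le> k" "k \<le> int N + 1" for b k
    proof -
      have "pval \<alpha> (\<lambda>j. if j = k then 1 else 0) (N + 1) (2 * 0) =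
        (\<Sum>j = - int N - 1..int N + 1. b (2 * j) * (if 0 + j = k then 1 else 0))"
        using that(1) unfolding is_mask_a_def by blast
      then show ?thesis
        using that by (simp add: if_distrib[of "\<lambda>x. _ * x"] cong: if_cong del: pval.simps)
    qed
    have od: "b (2 * k + 1) = pval \<alpha> (\<lambda>j. if j = k + 1 then 1 else 0) (N + 1) (2 * 0 + 1)"
      if "is_mask_a \<alpha> N b" "- int N - 1 \<le> k" "k \<le> int N" for b k
    proof -
      have "pval \<alpha> (\<lambda>j. if j = k + 1 then 1 else 0) (N + 1) (2 * 0 + 1) =
        (\<Sum>j = - int N - 1..int N. b (2 * j + 1) * (if 0 + j + 1 = k + 1 then 1 else 0))"
        using that(1) unfolding is_mask_a_def by blast
      then show ?thesis
        using that by (simp add: if_distrib[of "\<lambda>x. _ * x"] cong: if_cong del: pval.simps)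
    qed
    show "a' m = a'' m"
    proof (cases "\<bar>m\<bar> > 2 * (int N + 1)")
      case True
      then show ?thesis using a' a'' by (simp add: is_mask_a_def)
    next
      case False
      show ?thesis
      proof (cases "even m")
        case True
        then obtain k where "m = 2 * k" by blast
        with False show ?thesis using ev[OF a', of k] ev[OF a'', of k] by simp
      next
        case odd: False
        then obtain k where "m = 2 * k + 1" by (elim oddE)
        with False show ?thesis using od[OF a', of k] od[OF a'', of k] by simp
      qed
    qed
  qed
  ultimately show ?thesis by blast
qed

end

theory Submission
  imports Defs "HOL-Computational_Algebra.Formal_Power_Series"
begin

text \<open>
  Let \<open>E\<close> be the unit shift, \<open>\<delta>\<^sup>2 = E - 2 + E\<^sup>-\<^sup>1\<close> the second central difference and
  \<open>\<mu> = (E\<^sup>1\<^sup>/\<^sup>2 + E\<^sup>-\<^sup>1\<^sup>/\<^sup>2) / 2\<close> the mean, acting on polynomials. The even rule telescopes to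
  \<open>1 + \<alpha> (-1)\<^sup>N \<delta>\<^sup>2\<^sup>N\<^sup>+\<^sup>2\<close>, and \<open>\<delta>\<^sup>2\<^sup>N\<^sup>+\<^sup>2\<close> kills degree at most \<open>2N + 1\<close>. The odd rule is \<open>\<mu> T\<close>, where \<open>T\<close>
  is the expansion of \<open>(1 + \<delta>\<^sup>2 / 4)\<^sup>-\<^sup>1\<^sup>/\<^sup>2\<close> truncated after \<open>\<delta>\<^sup>2\<^sup>N\<close>. As \<open>\<mu>\<^sup>2 = 1 + \<delta>\<^sup>2 / 4\<close>, the operator
  \<open>\<mu> T\<close> squares to the identity on degree at most \<open>2N + 1\<close>; since it also preserves leading
  coefficients, it has no eigenvalue \<open>-1\<close>, so it is the identity there. The extra terms of the
  second family are a multiple of \<open>(1 + E) (E - 1)\<^sup>2\<^sup>N\<^sup>+\<^sup>2\<close>. Exactness of one step at every level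
  gives exact values at all levels.
\<close>

section \<open>Polynomials filtered by degree, and shifts\<close>

text \<open>The strict bound makes \<open>polys_below 0\<close> the zero space. An operator that
  lowers degrees then lowers the index by one without exception, whereas \<open>degree\<close> does
  not separate constants from zero.\<close>

definition polys_below :: "nat \<Rightarrow> real poly set" where
  "polys_below n = {g. \<forall>k\<ge>n. coeff g k = 0}"

lemma polys_below_degree: "g \<in> polys_below (Suc n) \<longleftrightarrow> degree g \<le> n"
  unfolding polys_below_def
  by (auto simp: coeff_eq_0 intro: degree_le)

lemma polys_below_0: "g \<in> polys_below 0 \<longleftrightarrow> g = 0"
  by (auto simp: polys_below_def poly_eq_iff)

lemma polys_below_mono: "g \<in> polys_below m \<Longrightarrow> m \<le> n \<Longrightarrow> g \<in> polys_below n"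
  by (auto simp: polys_below_def)

lemma polys_below_add: "g \<in> polys_below n \<Longrightarrow> h \<in> polys_below n \<Longrightarrow> g + h \<in> polys_below n"
  and polys_below_smult: "g \<in> polys_below n \<Longrightarrow> smult c g \<in> polys_below n"
  by (auto simp: polys_below_def)

lemma polys_below_sum: "(\<And>i. i \<in> A \<Longrightarrow> F i \<in> polys_below n) \<Longrightarrow> sum F A \<in> polys_below n"
  by (auto simp: polys_below_def coeff_sum)

lemma polys_below_pCons: "pCons a g \<in> polys_below (Suc n) \<longleftrightarrow> g \<in> polys_below n"
proof
  assume "pCons a g \<in> polys_below (Suc n)"
  then have "coeff (pCons a g) (Suc k) = 0" if "k \<ge> n" for k
    using that unfolding polys_below_def by blast
  then show "g \<in> polys_below n" by (auto simp: polys_below_def)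
next
  assume "g \<in> polys_below n"
  then show "pCons a g \<in> polys_below (Suc n)"
    by (auto simp: polys_below_def coeff_pCons split: nat.split)
qed

definition shift :: "real \<Rightarrow> real poly \<Rightarrow> real poly" where
  "shift c g = pcompose g [:c, 1:]"

lemma poly_shift: "poly (shift c g) x = poly g (x + c)"
  by (simp add: shift_def poly_pcompose add.commute)

text \<open>Write g = a + x h. The difference for g is x times the difference for h plus c times the
  shifted h, so induction applies.\<close>

lemma shift_minus_self_below:
  "g \<in> polys_below (Suc n) \<Longrightarrow> shift c g - g \<in> polys_below n"
proof (induction n arbitrary: g)
  case 0
  then have "degree g = 0" by (simp add: polys_below_degree)
  then show ?case by (auto elim!: degree_eq_zeroE simp: shift_def polys_below_def)
next
  case (Suc n)
  obtain a h where g: "g = pCons a h" by (cases g)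
  then have h: "h \<in> polys_below (Suc n)" using Suc.prems by (simp add: polys_below_pCons)
  have d: "shift c h - h \<in> polys_below n" using Suc.IH h .
  have "shift c h \<in> polys_below (Suc n)"
    using polys_below_add[OF h polys_below_mono[OF d]] by simp
  moreover have "shift c g - g = pCons 0 (shift c h - h) + smult c (shift c h)"
    by (simp add: g shift_def pcompose_pCons poly_eq_poly_eq_iff[symmetric] fun_eq_iff
        algebra_simps)
  ultimately show ?case
    using d by (simp add: polys_below_add polys_below_smult polys_below_pCons)
qed

section \<open>Central second difference and mean\<close>

definition diff2 :: "real poly \<Rightarrow> real poly" where
  "diff2 g = shift 1 g - smult 2 g + shift (-1) g"

definition mean :: "real poly \<Rightarrow> real poly" where
  "mean g = smult (1/2) (shift (1/2) g + shift (-1/2) g)"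

lemma poly_diff2: "poly (diff2 g) x = poly g (x + 1) - 2 * poly g x + poly g (x - 1)"
  by (simp add: diff2_def poly_shift)

lemma poly_mean: "poly (mean g) x = (poly g (x + 1/2) + poly g (x - 1/2)) / 2"
  by (simp add: mean_def poly_shift)

lemma real_poly_eqI: "(\<And>x. poly g x = poly h x) \<Longrightarrow> g = (h :: real poly)"
  by (simp add: poly_eq_poly_eq_iff[symmetric] fun_eq_iff)

lemma diff2_smult: "diff2 (smult c g) = smult c (diff2 g)"
  and diff2_add: "diff2 (g + h) = diff2 g + diff2 h"
  and diff2_diff: "diff2 (g - h) = diff2 g - diff2 h"
  and diff2_sum: "diff2 (sum F A) = (\<Sum>i\<in>A. diff2 (F i))"
  by (rule real_poly_eqI; simp add: poly_diff2 poly_sum algebra_simps sum.distrib sum_subtractf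
      sum_distrib_left)+

lemma smult_sum_right: "smult c (sum F A) = (\<Sum>i\<in>A. smult c (F i :: real poly))"
  by (rule real_poly_eqI) (simp add: poly_sum sum_distrib_left)

lemma mean_smult: "mean (smult c g) = smult c (mean g)"
  and mean_diff: "mean (g - h) = mean g - mean h"
  and mean_sum: "mean (sum F A) = (\<Sum>i\<in>A. mean (F i))"
  by (rule real_poly_eqI; simp add: poly_mean poly_sum algebra_simps sum.distrib
      sum_divide_distrib add_divide_distrib diff_divide_distrib)+

lemma mean_mean: "mean (mean g) = g + smult (1/4) (diff2 g)"
  by (rule real_poly_eqI) (simp add: poly_mean poly_diff2 algebra_simps add_divide_distrib)

lemma mean_diff2: "mean (diff2 g) = diff2 (mean g)"
  by (rule real_poly_eqI) (simp add: poly_mean poly_diff2 algebra_simps add_divide_distrib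
      diff_divide_distrib)

lemma diff2_funpow_smult: "(diff2 ^^ n) (smult c g) = smult c ((diff2 ^^ n) g)"
  by (induction n) (simp_all add: diff2_smult)

lemma diff2_funpow_diff: "(diff2 ^^ n) (g - h) = (diff2 ^^ n) g - (diff2 ^^ n) h"
  by (induction n) (simp_all add: diff2_diff)

lemma diff2_funpow_sum: "(diff2 ^^ n) (sum F A) = (\<Sum>i\<in>A. (diff2 ^^ n) (F i))"
  by (induction n) (simp_all add: diff2_sum)

lemma mean_diff2_funpow: "mean ((diff2 ^^ n) g) = (diff2 ^^ n) (mean g)"
  by (induction n) (simp_all add: mean_diff2)

text \<open>\<open>diff2\<close> factors as -(E^-1 - 1)(E - 1), and each factor lowers the bound by
  one.\<close>

lemma diff2_below:
  assumes "g \<in> polys_below (Suc (Suc n))"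
  shows "diff2 g \<in> polys_below n"
proof -
  define h where "h = shift 1 g - g"
  have "h \<in> polys_below (Suc n)" unfolding h_def by (rule shift_minus_self_below[OF assms])
  then have "smult (-1) (shift (-1) h - h) \<in> polys_below n"
    by (intro polys_below_smult shift_minus_self_below)
  also have "smult (-1) (shift (-1) h - h) = diff2 g"
    by (rule real_poly_eqI) (simp add: h_def poly_diff2 poly_shift)
  finally show ?thesis .
qed

lemma diff2_funpow_below: "g \<in> polys_below (2 * n + m) \<Longrightarrow> (diff2 ^^ n) g \<in> polys_below m"
proof (induction n arbitrary: m)
  case (Suc n)
  then have "(diff2 ^^ n) g \<in> polys_below (Suc (Suc m))" by (intro Suc.IH) simp
  then show ?case by (simp add: diff2_below)
qed simp

lemma diff2_funpow_eq_0: "g \<in> polys_below (2 * n) \<Longrightarrow> (diff2 ^^ n) g = 0"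
  using diff2_funpow_below[of g n 0] by (simp add: polys_below_0)

text \<open>This expresses that \<open>mean\<close> keeps the leading coefficient; it feeds the
  exclusion of the eigenvalue -1 in \<open>mean_bessel_eq\<close>.\<close>

lemma mean_minus_self_below:
  assumes "g \<in> polys_below (Suc n)"
  shows "mean g - g \<in> polys_below n"
proof -
  have "smult (1/2) ((shift (1/2) g - g) + (shift (-1/2) g - g)) \<in> polys_below n"
    by (intro polys_below_smult polys_below_add shift_minus_self_below assms)
  also have "smult (1/2) ((shift (1/2) g - g) + (shift (-1/2) g - g)) = mean g - g"
    by (rule real_poly_eqI) (simp add: poly_shift poly_mean add_divide_distrib diff_divide_distrib)
  finally show ?thesis .
qed

section \<open>The truncated inverse square root and midpoint interpolation\<close>

text \<open>The Taylor coefficients of \<open>(1 + x / 4)\<^sup>-\<^sup>1\<^sup>/\<^sup>2\<close>.\<close>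

definition bessel_coeff :: "nat \<Rightarrow> real" where
  "bessel_coeff n = ((-1/2) gchoose n) / 4 ^ n"

lemma bessel_coeff_0: "bessel_coeff 0 = 1"
  by (simp add: bessel_coeff_def)

text \<open>The bracketed factor is the one in the odd branch of \<open>corr\<close>. The minus sign
  appears because \<open>corr\<close> applies the negative of the second difference.\<close>

lemma bessel_coeff_Suc:
  "bessel_coeff (Suc n) = - (1 / real (Suc n) * (real (Suc n) / 4 - 1 / 8)) * bessel_coeff n"
proof -
  have "((-1/2) gchoose Suc n) = ((-1/2 - real n) / real (Suc n)) * ((-1/2) gchoose n)"
    using gbinomial_absorption[of n "-1/2 :: real"] gbinomial_absorb_comp[of "-1/2 :: real" n]
    by (simp add: field_simps)
  moreover have "- (1 / real (Suc n) * (real (Suc n) / 4 - 1 / 8)) = (-1/2 - real n) / real (Suc n) / 4"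
    by (simp add: field_simps)
  ultimately show ?thesis by (simp only: bessel_coeff_def power_Suc) simp
qed

text \<open>The square of the series is (1 + x/4)^-1, a geometric series; on coefficients this is
  Vandermonde's identity with both upper entries -1/2.\<close>

lemma bessel_coeff_convolution: "(\<Sum>i\<le>n. bessel_coeff i * bessel_coeff (n - i)) = (-1/4) ^ n"
proof -
  have "(\<Sum>i\<le>n. bessel_coeff i * bessel_coeff (n - i)) =
      (\<Sum>i\<le>n. ((-1/2) gchoose i) * ((-1/2) gchoose (n - i))) / 4 ^ n"
    by (simp add: bessel_coeff_def sum_divide_distrib power_add[symmetric])
  also have "(\<Sum>i\<le>n. ((-1/2) gchoose i) * ((-1/2) gchoose (n - i))) = ((-1 :: real) gchoose n)"
    using gbinomial_Vandermonde[of "-1/2 :: real" "-1/2" n] by (simp add: atLeast0AtMost)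
  also have "\<dots> = (-1) ^ n"
    using gbinomial_minus[of "1 :: real" n] by (simp add: binomial_gbinomial[symmetric])
  finally show ?thesis by (simp add: power_minus[of "1/4"] power_one_over)
qed

text \<open>At a half-integer, \<open>mean (bessel N g)\<close> is Bessel's central-difference
  formula for interpolation to halves, truncated.\<close>

definition bessel :: "nat \<Rightarrow> real poly \<Rightarrow> real poly" where
  "bessel N g = (\<Sum>n\<le>N. smult (bessel_coeff n) ((diff2 ^^ n) g))"

lemma mean_bessel: "mean (bessel N g) = bessel N (mean g)"
  by (simp add: bessel_def mean_sum mean_smult mean_diff2_funpow)

lemma bessel_diff: "bessel N (g - h) = bessel N g - bessel N h"
  by (simp add: bessel_def diff2_funpow_diff smult_diff_right sum_subtractf)

lemma bessel_minus_self_below: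
  assumes "g \<in> polys_below (Suc n)"
  shows "bessel N g - g \<in> polys_below n"
proof -
  have "bessel N g - g = (\<Sum>k\<in>{..N} - {0}. smult (bessel_coeff k) ((diff2 ^^ k) g))"
    by (simp add: bessel_def sum.remove[of "{..N}" 0] bessel_coeff_0)
  also have "\<dots> \<in> polys_below n"
  proof (intro polys_below_sum polys_below_smult)
    fix k assume "k \<in> {..N} - {0}"
    then show "(diff2 ^^ k) g \<in> polys_below n"
      by (intro diff2_funpow_below polys_below_mono[OF assms]) auto
  qed
  finally show ?thesis .
qed

text \<open>Products of total order above N vanish by the degree bound, so squaring the truncated
  series gives the truncation of the squared series.\<close>

lemma bessel_bessel:
  assumes "g \<in> polys_below (2 * N + 2)"
  shows "bessel N (bessel N g) = (\<Sum>n\<le>N. smult ((-1/4) ^ n) ((diff2 ^^ n) g))"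
proof -
  let ?F = "\<lambda>i j. smult (bessel_coeff i * bessel_coeff j) ((diff2 ^^ (i + j)) g)"
  have zero: "(diff2 ^^ n) g = 0" if "n > N" for n
    by (rule diff2_funpow_eq_0) (use that assms in \<open>auto intro: polys_below_mono\<close>)
  have "bessel N (bessel N g) = (\<Sum>i\<le>N. \<Sum>j\<le>N. ?F i j)"
    by (simp add: bessel_def diff2_funpow_sum diff2_funpow_smult smult_sum_right funpow_add)
  also have "\<dots> = (\<Sum>(i, j)\<in>{..N} \<times> {..N}. ?F i j)"
    by (simp add: sum.cartesian_product)
  also have "\<dots> = (\<Sum>(i, j)\<in>{(i, j). i + j \<le> N}. ?F i j)"
    by (rule sum.mono_neutral_right) (auto, use zero not_le in blast)
  also have "\<dots> = (\<Sum>n\<le>N. \<Sum>i\<le>n. ?F i (n - i))"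
    by (rule sum.triangle_reindex_eq)
  also have "\<dots> = (\<Sum>n\<le>N. smult (\<Sum>i\<le>n. bessel_coeff i * bessel_coeff (n - i)) ((diff2 ^^ n) g))"
    by (simp add: smult_sum)
  finally show ?thesis by (simp add: bessel_coeff_convolution)
qed

text \<open>Multiplying the truncated geometric series by 1 + x/4 telescopes to 1 minus the first
  omitted term.\<close>

lemma geometric_diff2:
  "(\<Sum>n\<le>N. smult ((-1/4) ^ n) ((diff2 ^^ n) g)) +
     smult (1/4) (diff2 (\<Sum>n\<le>N. smult ((-1/4) ^ n) ((diff2 ^^ n) g))) =
   g - smult ((-1/4) ^ Suc N) ((diff2 ^^ Suc N) g)"
proof (induction N)
  case 0
  then show ?case by simp
next
  case (Suc N)
  define a where "a = smult ((-1/4) ^ Suc N) ((diff2 ^^ Suc N) g)"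
  define S where "S = (\<Sum>n\<le>N. smult ((-1/4) ^ n) ((diff2 ^^ n) g))"
  have "(S + a) + smult (1/4) (diff2 (S + a)) =
      (S + smult (1/4) (diff2 S)) + a + smult (1/4) (diff2 a)"
    by (simp add: diff2_add smult_add_right)
  also have "S + smult (1/4) (diff2 S) = g - a"
    using Suc unfolding S_def a_def .
  also have "smult (1/4) (diff2 a) = - smult ((-1/4) ^ Suc (Suc N)) ((diff2 ^^ Suc (Suc N)) g)"
    by (simp only: a_def diff2_smult funpow.simps o_apply smult_smult power_Suc) simp
  finally show ?case by (simp add: S_def a_def)
qed

lemma mean_bessel_eq:
  assumes g: "g \<in> polys_below (2 * N + 2)"
  shows "mean (bessel N g) = g"
proof -
  define U where "U = (\<lambda>g. mean (bessel N g))"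
  have U_diff: "U (g - h) = U g - U h" for g h
    by (simp add: U_def bessel_diff mean_diff)
  have below: "U h - h \<in> polys_below n" if h: "h \<in> polys_below (Suc n)" for h n
  proof -
    have b: "bessel N h - h \<in> polys_below n" by (rule bessel_minus_self_below[OF h])
    then have "bessel N h \<in> polys_below (Suc n)"
      using polys_below_add[OF h polys_below_mono[OF b]] by simp
    from polys_below_add[OF mean_minus_self_below[OF this] b] show ?thesis
      by (simp add: U_def)
  qed
  have "U (U g) = mean (mean (bessel N (bessel N g)))"
    by (simp add: U_def mean_bessel)
  also have "\<dots> = g - smult ((-1/4) ^ Suc N) ((diff2 ^^ Suc N) g)"
    unfolding mean_mean bessel_bessel[OF g] by (rule geometric_diff2)
  also have "(diff2 ^^ Suc N) g = 0"
    using g by (intro diff2_funpow_eq_0) simp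
  finally have UU: "U (U g) = g" by simp
  \<comment> \<open>Such an \<open>h\<close> equals -1/2 (U h - h), which lies one bound lower;
    descending ends in the zero space.\<close>
  have eigen: "h = 0" if "h \<in> polys_below n" "U h = - h" for h n
    using that
  proof (induction n)
    case 0
    then show ?case by (simp add: polys_below_0)
  next
    case (Suc n)
    have "smult (-1/2) (U h - h) \<in> polys_below n"
      by (intro polys_below_smult below Suc.prems)
    also have "smult (-1/2) (U h - h) = h"
      by (rule real_poly_eqI) (simp add: Suc.prems)
    finally show ?case using Suc by blast
  qed
  have "U g - g \<in> polys_below (2 * N + 1)" using g by (intro below) simp
  moreover have "U (U g - g) = - (U g - g)" by (simp add: U_diff UU)
  ultimately have "U g - g = 0" by (rule eigen)
  then show ?thesis by (simp add: U_def)
qed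

section \<open>The rules applied to sampled polynomials\<close>

abbreviation samples :: "real poly \<Rightarrow> int \<Rightarrow> real" where
  "samples g \<equiv> \<lambda>i. poly g (real_of_int i)"

text \<open>The initial value is (1 + \<open>diff2\<close>) g and each recursion step applies
  -\<open>diff2\<close>. Two consecutive orders with alternating sign are what makes
  \<open>pval_even_samples\<close> telescope.\<close>

lemma corr_even_samples:
  "corr (samples g) (Suc n) (2 * i) =
     (-1) ^ n * poly ((diff2 ^^ n) g + (diff2 ^^ Suc n) g) (real_of_int i)"
proof (induction n arbitrary: i)
  case 0
  then show ?case by (simp add: poly_diff2)
next
  case (Suc n)
  have "corr (samples g) (Suc (Suc n)) (2 * i) =
      (corr (samples g) (Suc n) (2 * i) - corr (samples g) (Suc n) (2 * (i + 1))) +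
      (corr (samples g) (Suc n) (2 * i) - corr (samples g) (Suc n) (2 * (i - 1)))"
    by (simp only: corr.simps(2)[of _ "Suc n"]) (simp del: corr.simps add: algebra_simps)
  also have "\<dots> = (-1) ^ Suc n *
      poly (diff2 ((diff2 ^^ n) g) + diff2 ((diff2 ^^ Suc n) g)) (real_of_int i)"
    unfolding Suc.IH by (simp add: poly_diff2[of "(diff2 ^^ n) g"]
        poly_diff2[of "diff2 ((diff2 ^^ n) g)"] algebra_simps)
  finally show ?case by simp
qed

lemma pval_even_samples:
  "pval \<alpha> (samples g) (Suc n) (2 * i) =
     poly g (real_of_int i) + \<alpha> * (-1) ^ n * poly ((diff2 ^^ Suc n) g) (real_of_int i)"
proof (induction n)
  case 0
  then show ?case by (simp add: poly_diff2)
next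
  case (Suc n)
  have "pval \<alpha> (samples g) (Suc (Suc n)) (2 * i) =
      pval \<alpha> (samples g) (Suc n) (2 * i) + \<alpha> * corr (samples g) (Suc (Suc n)) (2 * i)"
    by (simp only: pval.simps(2)[of _ _ "Suc n"]) (simp del: corr.simps pval.simps)
  then show ?case unfolding corr_even_samples Suc by (simp add: algebra_simps)
qed

text \<open>The odd corrections are the successive terms of the Bessel formula at the
  midpoint.\<close>

lemma corr_odd_samples:
  "corr (samples g) (Suc n) (2 * i + 1) =
     bessel_coeff n * poly (mean ((diff2 ^^ n) g)) (real_of_int i + 1/2)"
proof (induction n arbitrary: i)
  case 0
  then show ?case by (simp add: poly_mean bessel_coeff_0 add.commute)
next
  case (Suc n)
  define r where "r = 1 / real (Suc n) * (real (Suc n) / 4 - 1 / 8)"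
  have "corr (samples g) (Suc (Suc n)) (2 * i + 1) =
      r * ((corr (samples g) (Suc n) (2 * i + 1) - corr (samples g) (Suc n) (2 * (i + 1) + 1)) +
      (corr (samples g) (Suc n) (2 * i + 1) - corr (samples g) (Suc n) (2 * (i - 1) + 1)))"
    by (simp only: corr.simps(2)[of _ "Suc n"] r_def) (simp del: corr.simps add: algebra_simps)
  also have "\<dots> = - r * bessel_coeff n *
      poly (diff2 (mean ((diff2 ^^ n) g))) (real_of_int i + 1/2)"
    unfolding Suc.IH by (simp add: poly_diff2 algebra_simps)
  finally show ?case by (simp only: bessel_coeff_Suc r_def mean_diff2 funpow.simps o_apply)
qed

lemma pval_odd_samples:
  "pval \<alpha> (samples g) (Suc n) (2 * i + 1) = poly (mean (bessel n g)) (real_of_int i + 1/2)"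
proof (induction n)
  case 0
  then show ?case by (simp add: poly_mean bessel_def bessel_coeff_0 add.commute)
next
  case (Suc n)
  have "pval \<alpha> (samples g) (Suc (Suc n)) (2 * i + 1) =
      pval \<alpha> (samples g) (Suc n) (2 * i + 1) + corr (samples g) (Suc (Suc n)) (2 * i + 1)"
    by (simp only: pval.simps(2)[of _ _ "Suc n"]) (simp del: corr.simps pval.simps)
  then show ?case
    unfolding corr_odd_samples Suc
    by (simp only: bessel_def mean_sum mean_smult poly_sum poly_smult)
      (simp only: sum.atMost_Suc)
qed

lemma is_mask_a_mask_a: "is_mask_a \<alpha> N (mask_a \<alpha> N)"
  unfolding mask_a_def by (rule theI'[OF is_mask_a_ex1])

text \<open>The defining property of the mask turns the scheme back into \<open>pval\<close>, so no
  mask coefficient has to be computed.\<close>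

lemma scheme_a_even: "scheme_a \<alpha> N f (2 * i) = pval \<alpha> f (Suc N) (2 * i)"
  using is_mask_a_mask_a[of \<alpha> N] by (simp add: scheme_a_def is_mask_a_def del: pval.simps)

lemma scheme_a_odd: "scheme_a \<alpha> N f (2 * i + 1) = pval \<alpha> f (Suc N) (2 * i + 1)"
  using is_mask_a_mask_a[of \<alpha> N] by (simp add: scheme_a_def is_mask_a_def del: pval.simps)

lemma scheme_a_samples:
  assumes "g \<in> polys_below (2 * N + 2)"
  shows "scheme_a \<alpha> N (samples g) m = poly g (real_of_int m / 2)"
proof (cases "even m")
  case True
  then obtain i where "m = 2 * i" by blast
  moreover have "(diff2 ^^ Suc N) g = 0"
    using assms by (intro diff2_funpow_eq_0) simp
  ultimately show ?thesis by (simp only: scheme_a_even pval_even_samples) simp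
next
  case False
  then obtain i where "m = 2 * i + 1" by (elim oddE)
  then show ?thesis
    by (simp only: scheme_a_odd pval_odd_samples mean_bessel_eq[OF assms])
      (simp add: add_divide_distrib)
qed

section \<open>Alternating binomial sums and the extra odd terms\<close>

text \<open>The weights on the left are the coefficients of (1 - z)^M (1 - c z). Taking c = 1 gives
  Pascal's rule, c = -1 the factor 1 + E of the extra terms.\<close>

lemma sum_alternating_choose_split:
  fixes u :: "nat \<Rightarrow> real"
  shows "(\<Sum>k\<le>Suc M. (-1) ^ k *
      (real (M choose k) + c * (if k = 0 then 0 else real (M choose (k - 1)))) * u k) =
    (\<Sum>k\<le>M. (-1) ^ k * real (M choose k) * (u k - c * u (Suc k)))"
proof -
  have "(\<Sum>k\<le>Suc M. (-1) ^ k *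
      (real (M choose k) + c * (if k = 0 then 0 else real (M choose (k - 1)))) * u k) =
      (\<Sum>k\<le>Suc M. (-1) ^ k * real (M choose k) * u k) +
      (\<Sum>k\<le>Suc M. (-1) ^ k * (c * (if k = 0 then 0 else real (M choose (k - 1)))) * u k)"
    by (simp add: algebra_simps sum.distrib del: sum.atMost_Suc)
  also have "(\<Sum>k\<le>Suc M. (-1) ^ k * real (M choose k) * u k) =
      (\<Sum>k\<le>M. (-1) ^ k * real (M choose k) * u k)"
    by simp
  also have "(\<Sum>k\<le>Suc M. (-1) ^ k * (c * (if k = 0 then 0 else real (M choose (k - 1)))) * u k) =
      (\<Sum>k\<le>M. - ((-1) ^ k * real (M choose k) * c * u (Suc k)))"
    by (subst sum.atMost_Suc_shift) (simp add: algebra_simps)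
  finally show ?thesis by (simp add: algebra_simps sum_subtractf sum_negf)
qed

text \<open>Up to sign this is the M-th forward difference; each Pascal step takes one difference
  and lowers the bound by one.\<close>

lemma alternating_choose_sum_poly_eq_0:
  "g \<in> polys_below M \<Longrightarrow> (\<Sum>k\<le>M. (-1) ^ k * real (M choose k) * poly g (x + real k)) = 0"
proof (induction M arbitrary: g)
  case 0
  then show ?case by (simp add: polys_below_0)
next
  case (Suc M)
  have "real (Suc M choose k) =
      real (M choose k) + 1 * (if k = 0 then 0 else real (M choose (k - 1)))" for k
    by (cases k) simp_all
  then have "(\<Sum>k\<le>Suc M. (-1) ^ k * real (Suc M choose k) * poly g (x + real k)) =
      (\<Sum>k\<le>M. (-1) ^ k * real (M choose k) * (poly g (x + real k) - 1 * poly g (x + real (Suc k))))"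
    by (simp only: sum_alternating_choose_split)
  also have "\<dots> = - (\<Sum>k\<le>M. (-1) ^ k * real (M choose k) * poly (shift 1 g - g) (x + real k))"
    by (simp add: poly_shift sum_negf[symmetric] algebra_simps)
  finally show ?case using Suc.IH[OF shift_minus_self_below[OF Suc.prems, of 1]] by simp
qed

text \<open>These are the extra odd terms with \<beta> (1 - \<alpha>) taken out. The value 1 is
  meant for the two end indices -N-2 and N+1 only.\<close>

definition extra_coeff :: "nat \<Rightarrow> int \<Rightarrow> real" where
  "extra_coeff N j =
     (if - int N - 1 \<le> j \<and> j \<le> int N then
        (- 1) powi (j + int N + 1) * ((2 * real_of_int j + 1) / (real N - real_of_int j + 1)) *
          real ((2 * N + 2) choose nat (int N + j + 2))
      else 1)"

text \<open>The extra coefficients are those of \<open>(1 + E) (E - 1)\<^sup>2\<^sup>N\<^sup>+\<^sup>2\<close>, with \<open>k\<close> counted from the left end.\<close>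

lemma extra_coeff_eq:
  assumes "k \<le> 2 * N + 3"
  shows "extra_coeff N (int k - int N - 2) =
    (-1) ^ k * (real ((2 * N + 2) choose k) +
      (-1) * (if k = 0 then 0 else real ((2 * N + 2) choose (k - 1))))"
proof (cases "k = 0 \<or> k = 2 * N + 3")
  case True
  then show ?thesis
    by (auto simp: extra_coeff_def)
next
  case False
  \<comment> \<open>Here j = l - N - 1, so the binomial has lower entry l + 1 and the denominator N
    - j + 1 is 2N + 2 - l. Absorption then turns the quotient into a difference of neighbouring
    binomials.\<close>
  then obtain l where l: "k = Suc l" by (cases k) auto
  have l': "l \<le> 2 * N + 1" using False assms l by simp
  have "Suc l * ((2 * N + 2) choose Suc l) = (2 * N + 2 - l) * ((2 * N + 2) choose l)"
    by (metis binomial_absorb_comp binomial_absorption mult.commute)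
  then have "real (Suc l) * real ((2 * N + 2) choose Suc l) =
      real (2 * N + 2 - l) * real ((2 * N + 2) choose l)"
    by (metis of_nat_mult)
  then have rel: "(real l + 1) * real ((2 * N + 2) choose Suc l) =
      (2 * real N + 2 - real l) * real ((2 * N + 2) choose l)"
    using l' by (simp add: of_nat_diff algebra_simps del: binomial_Suc_Suc)
  have pos: "2 * real N + 2 - real l > 0" using l' by linarith
  have "(- 1 :: real) powi (int l - int N - 1 + int N + 1) = (-1) ^ l"
    by simp
  moreover have "nat (int N + (int l - int N - 1) + 2) = Suc l" by simp
  moreover have "- int N - 1 \<le> int l - int N - 1 \<and> int l - int N - 1 \<le> int N" using l' by simp
  ultimately have "extra_coeff N (int l - int N - 1) =
      (-1) ^ l * ((2 * real l - 2 * real N - 1) / (2 * real N + 2 - real l)) *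
        real ((2 * N + 2) choose Suc l)"
    by (simp add: extra_coeff_def algebra_simps)
  also have "((2 * real l - 2 * real N - 1) / (2 * real N + 2 - real l)) *
        real ((2 * N + 2) choose Suc l) =
      real ((2 * N + 2) choose l) - real ((2 * N + 2) choose Suc l)"
    using rel pos by (simp add: field_simps)
  then have "(-1) ^ l * ((2 * real l - 2 * real N - 1) / (2 * real N + 2 - real l)) *
        real ((2 * N + 2) choose Suc l) =
      (-1) ^ l * (real ((2 * N + 2) choose l) - real ((2 * N + 2) choose Suc l))"
    by (simp only: mult.assoc)
  finally show ?thesis by (simp add: l algebra_simps)
qed

lemma extra_coeff_sum_eq_0:
  assumes "g \<in> polys_below (2 * N + 2)"
  shows "(\<Sum>j = - int N - 2..int N + 1. extra_coeff N j * samples g (i + j + 1)) = 0"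
proof -
  \<comment> \<open>The leftmost sample point, reached at j = -N-2.\<close>
  define x where "x = real_of_int i - real N - 1"
  define M where "M = 2 * N + 2"
  have "(\<Sum>j = - int N - 2..int N + 1. extra_coeff N j * samples g (i + j + 1)) =
      (\<Sum>k\<le>Suc M. extra_coeff N (int k - int N - 2) * poly g (x + real k))"
    by (rule sum.reindex_bij_witness[of _ "\<lambda>k. int k - int N - 2" "\<lambda>j. nat (j + int N + 2)"])
      (auto simp: x_def M_def algebra_simps)
  also have "\<dots> = (\<Sum>k\<le>Suc M. (-1) ^ k * (real (M choose k) +
      (-1) * (if k = 0 then 0 else real (M choose (k - 1)))) * poly g (x + real k))"
    by (rule sum.cong[OF refl], subst extra_coeff_eq) (auto simp: M_def)
  also have "\<dots> = (\<Sum>k\<le>M. (-1) ^ k * real (M choose k) *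
      (poly g (x + real k) - (-1) * poly g (x + real (Suc k))))"
    by (rule sum_alternating_choose_split)
  \<comment> \<open>The factor 1 + E leaves two differences of order 2N + 2, based at x and x +
    1.\<close>
  also have "\<dots> = (\<Sum>k\<le>M. (-1) ^ k * real (M choose k) * poly g (x + real k)) +
      (\<Sum>k\<le>M. (-1) ^ k * real (M choose k) * poly g (x + 1 + real k))"
    by (simp add: sum.distrib[symmetric] algebra_simps)
  also have "\<dots> = 0"
    using assms unfolding M_def by (simp only: alternating_choose_sum_poly_eq_0)
  finally show ?thesis .
qed

lemma mask_b_odd:
  assumes "- int N - 2 \<le> j" "j \<le> int N + 1"
  shows "mask_b \<alpha> \<beta> N (2 * j + 1) =
    mask_a \<alpha> N (2 * j + 1) + \<beta> * (1 - \<alpha>) * extra_coeff N j"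
proof (cases "- int N - 1 \<le> j \<and> j \<le> int N")
  case True
  then show ?thesis by (simp add: mask_b_def extra_coeff_def)
next
  case False
  \<comment> \<open>At the two end indices 2j + 1 is -(2N+3) or 2N+3, just outside the support of
    \<open>mask_a\<close>.\<close>
  then have "\<bar>2 * j + 1\<bar> > 2 * (int N + 1)" and "j = - (int N + 2) \<or> j = int N + 1"
    using assms by auto
  moreover from this have "mask_a \<alpha> N (2 * j + 1) = 0"
    using is_mask_a_mask_a[of \<alpha> N] by (simp add: is_mask_a_def)
  ultimately show ?thesis using False by (auto simp: mask_b_def extra_coeff_def)
qed

lemma scheme_b_even: "scheme_b \<alpha> \<beta> N f (2 * i) = scheme_a \<alpha> N f (2 * i)"
  by (simp add: scheme_b_def scheme_a_def mask_b_def)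

lemma scheme_b_odd:
  "scheme_b \<alpha> \<beta> N f (2 * i + 1) = scheme_a \<alpha> N f (2 * i + 1) +
     \<beta> * (1 - \<alpha>) * (\<Sum>j = - int N - 2..int N + 1. extra_coeff N j * f (i + j + 1))"
proof -
  have zero: "mask_a \<alpha> N (2 * j + 1) = 0" if "j < - int N - 1 \<or> j > int N" for j
    using is_mask_a_mask_a[of \<alpha> N] that by (auto simp: is_mask_a_def)
  have "scheme_b \<alpha> \<beta> N f (2 * i + 1) =
      (\<Sum>j = - int N - 2..int N + 1. mask_b \<alpha> \<beta> N (2 * j + 1) * f (i + j + 1))"
    by (simp add: scheme_b_def)
  also have "\<dots> = (\<Sum>j = - int N - 2..int N + 1. mask_a \<alpha> N (2 * j + 1) * f (i + j + 1) +
      \<beta> * (1 - \<alpha>) * (extra_coeff N j * f (i + j + 1)))"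
    by (rule sum.cong[OF refl]) (subst mask_b_odd; simp add: distrib_right)
  also have "\<dots> = (\<Sum>j = - int N - 2..int N + 1. mask_a \<alpha> N (2 * j + 1) * f (i + j + 1)) +
      \<beta> * (1 - \<alpha>) * (\<Sum>j = - int N - 2..int N + 1. extra_coeff N j * f (i + j + 1))"
    by (simp only: sum.distrib sum_distrib_left)
  also have "(\<Sum>j = - int N - 2..int N + 1. mask_a \<alpha> N (2 * j + 1) * f (i + j + 1)) =
      (\<Sum>j = - int N - 1..int N. mask_a \<alpha> N (2 * j + 1) * f (i + j + 1))"
    by (rule sum.mono_neutral_right) (auto simp: zero)
  finally show ?thesis by (simp add: scheme_a_def)
qed

lemma scheme_b_samples:
  assumes "g \<in> polys_below (2 * N + 2)"
  shows "scheme_b \<alpha> \<beta> N (samples g) m = poly g (real_of_int m / 2)"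
proof (cases "even m")
  case True
  then obtain i where "m = 2 * i" by blast
  then show ?thesis using scheme_a_samples[OF assms] by (simp only: scheme_b_even)
next
  case False
  then obtain i where "m = 2 * i + 1" by (elim oddE)
  then show ?thesis
    using scheme_a_samples[OF assms] extra_coeff_sum_eq_0[OF assms] by (simp only: scheme_b_odd)
qed

section \<open>From one exact step to the limit\<close>

lemma reproduces_polysI:
  assumes step: "\<And>g m. degree g \<le> d \<Longrightarrow> S (samples g) m = poly g (real_of_int m / 2)"
  shows "reproduces_polys S d"
  unfolding reproduces_polys_def
proof (intro allI impI)
  fix g :: "real poly" assume deg: "degree g \<le> d"
  have exact: "(S ^^ k) (samples g) = (\<lambda>i. poly g (real_of_int i / 2 ^ k))" for k
  proof (induction k)
    case 0
    then show ?case by simp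
  next
    case (Suc k)
    \<comment> \<open>The level k data are integer samples of g rescaled by 2^-k, again a polynomial
      of degree at most d, so the one-step hypothesis applies to it.\<close>
    define h where "h = pcompose g [:0, 1 / 2 ^ k:]"
    have "degree h \<le> d"
      using deg by (simp add: h_def degree_pcompose)
    moreover have h: "poly h x = poly g (x / 2 ^ k)" for x
      by (simp add: h_def poly_pcompose)
    ultimately have "S (samples h) m = poly g (real_of_int m / 2 ^ Suc k)" for m
      using step[of h m] by (simp add: h)
    then show ?case by (simp add: Suc h fun_eq_iff)
  qed
  \<comment> \<open>All errors are zero. An empty index set is treated separately: its supremum is
    the bottom of \<open>ennreal\<close>, which is also 0.\<close>
  have sup0: "(SUP i\<in>A. (0 :: ennreal)) = 0" for A :: "int set"
    by (cases "A = {}") (simp_all add: bot_ennreal)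
  show "is_limit S (samples g) (poly g)"
    unfolding is_limit_def exact
    by (auto simp: sup0 intro!: continuous_intros simp del: SUP_constant)
qed

theorem theorem4p3:
  fixes N :: nat
  shows "(\<forall>\<alpha> :: real. reproduces_polys (scheme_a \<alpha> N) (2 * N + 1)) \<and>
         (\<forall>\<alpha> \<beta> :: real. -1 < \<alpha> \<and> \<alpha> < 1 \<and> -1 < \<beta> \<and> \<beta> < 1 \<longrightarrow>
            reproduces_polys (scheme_b \<alpha> \<beta> N) (2 * N + 1)) \<and>
         (\<forall>\<beta> :: real. -1 < \<beta> \<and> \<beta> < 1 \<longrightarrow>
            reproduces_polys (scheme_I \<beta> N) (2 * N + 1))"
proof -
  have below: "g \<in> polys_below (2 * N + 2)" if "degree g \<le> 2 * N + 1" for g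
    using that polys_below_degree[of g "2 * N + 1"] by simp
  have a: "reproduces_polys (scheme_a \<alpha> N) (2 * N + 1)" for \<alpha>
    by (intro reproduces_polysI scheme_a_samples below)
  have b: "reproduces_polys (scheme_b \<alpha> \<beta> N) (2 * N + 1)" for \<alpha> \<beta>
    by (intro reproduces_polysI scheme_b_samples below)
  show ?thesis using a b by (simp add: scheme_I_def)
qed

end
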